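(* Let $n\ge5$ be odd, let $E$, $S$, $\omega$, $\theta_k$, $x_j$ be as in the context, and let $\nabla=\{1,\dots,n-2\}\setminus\{\frac{n-1}{2}\}$. For $k\in\{1,\dots,n-2\}$ define $q_k=(0,u_k',v_k')'$ where, for $k\in\nabla$, $v_k=(1,\omega^k,\dots,\omega^{(n-2)k})'$ and $u_k=\frac{-1}{8\cos^2(\frac{\pi k}{n-1})}Sv_k$, while for $k=\frac{n-1}{2}$, $u_k=(1,-1,1,-1,\dots,1,-1)'\in\mathbb{R}^{n-1}$ and $v_k=\mathbf{0}$. Then: (i) $Eq_k=\theta_kq_k$ for all $k$; (ii) $q_1,\dots,q_{n-2}$ are mutually orthogonal; (iii) $\langle x_j,q_k\rangle=0$ for all $j\in\{1,2\}$ and all $k$; (iv) $\langle\mathbf{1},q_k\rangle=0$ for all $k$.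
   Context: $\mathbf{1}_p$ all-ones vector in $\mathbb{R}^p$, $\mathbf{1}=\mathbf{1}_{2n-1}$, $J_p=\mathbf{1}_p\mathbf{1}_p'$, $I_p$ identity, $X'$ transpose, $\langle x,y\rangle=y^*x$. $\mathrm{Circ}(a_1,\dots,a_p)$ is the circulant matrix with first row $(a_1,\dots,a_p)$, each subsequent row the previous one shifted cyclically one position to the right. $S=\mathrm{Circ}(1,3,\dots,3,1)$ (size $n-1$, $n-3$ threes), $T=\mathrm{Circ}(0,2,4,\dots,4,2)$ (size $n-1$, $n-4$ fours), \[E=\begin{bmatrix}0&\mathbf{1}_{n-1}'&2\mathbf{1}_{n-1}'\\ \mathbf{1}_{n-1}&2(J_{n-1}-I_{n-1})&S\\ 2\mathbf{1}_{n-1}&S'&T\end{bmatrix}\] (the distance matrix of the gear graph on $2n-1$ vertices). $\omega=e^{2\pi i/(n-1)}$, $\theta_k=-8\cos^2(\frac{\pi k}{n-1})-2$. For $j=1,2$: $x_j=(\alpha_j,\beta_j\mathbf{1}_{n-1}',\mathbf{1}_{n-1}')'$ with $\alpha_j=\frac{15-5n-2(-1)^j\sqrt5\sqrt{n(2n-9)+12}}{3(n-1)}$, $\beta_j=\frac{6-n-(-1)^j\sqrt5\sqrt{n(2n-9)+12}}{3(n-1)}$. *)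

theory Defs
  imports Complex_Main "Jordan_Normal_Form.Matrix"
begin

text \<open>Everything is stated over the complex numbers, since the eigenvectors are complex; the
  matrices and the vectors \<open>gear_x n j\<close> have real entries. The inner product
  \<open>\<langle>x, y\<rangle> = y\<^sup>* x\<close> is \<open>x \<bullet>c y\<close>, which conjugates its second argument.
  Vectors and matrices are indexed from 0.\<close>

definition ones_vec :: "nat \<Rightarrow> complex vec" where
  "ones_vec p = vec p (\<lambda>i. 1)"

definition ones_row :: "nat \<Rightarrow> complex mat" where
  "ones_row p = mat_of_row (ones_vec p)"

definition ones_col :: "nat \<Rightarrow> complex mat" where
  "ones_col p = mat_of_cols p [ones_vec p]"

definition J_mat :: "nat \<Rightarrow> complex mat" where
  "J_mat p = ones_col p * ones_row p"

text \<open>The circulant matrix with first row \<open>as\<close>. Row \<open>i\<close> is \<open>as\<close> shifted cyclically \<open>i\<close> positions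
  to the right, so its entry \<open>j\<close> is \<open>as ! ((j - i) mod p)\<close> for the integer residue; \<open>p\<close> is added
  because subtraction of naturals truncates.\<close>

definition circ_mat :: "complex list \<Rightarrow> complex mat" where
  "circ_mat as = mat (length as) (length as)
     (\<lambda>(i, j). as ! ((j + length as - i) mod length as))"

definition gear_S :: "nat \<Rightarrow> complex mat" where
  "gear_S n = circ_mat (1 # replicate (n - 3) 3 @ [1])"

definition gear_T :: "nat \<Rightarrow> complex mat" where
  "gear_T n = circ_mat (0 # 2 # replicate (n - 4) 4 @ [2])"

text \<open>The three-by-three block matrix, partitioned as \<open>n + (n - 1)\<close>: its lower left block
  \<open>[2 1, S']\<close> is the transpose of its upper right block, \<open>2 1'\<close> stacked on \<open>S\<close>.\<close>

definition gear_E :: "nat \<Rightarrow> complex mat" where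
  "gear_E n = four_block_mat
     (four_block_mat (0\<^sub>m 1 1)          (ones_row (n - 1))
                     (ones_col (n - 1)) (2 \<cdot>\<^sub>m (J_mat (n - 1) - 1\<^sub>m (n - 1))))
     ((2 \<cdot>\<^sub>m ones_row (n - 1)) @\<^sub>r gear_S n)
     (transpose_mat ((2 \<cdot>\<^sub>m ones_row (n - 1)) @\<^sub>r gear_S n))
     (gear_T n)"

definition gear_omega :: "nat \<Rightarrow> complex" where
  "gear_omega n = exp (2 * of_real pi * \<i> / of_nat (n - 1))"

definition gear_theta :: "nat \<Rightarrow> nat \<Rightarrow> real" where
  "gear_theta n k = - 8 * (cos (pi * real k / real (n - 1)))\<^sup>2 - 2"

definition gear_alpha :: "nat \<Rightarrow> nat \<Rightarrow> real" where
  "gear_alpha n j =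
     (15 - 5 * real n - 2 * (-1) ^ j * sqrt 5 * sqrt (real n * (2 * real n - 9) + 12))
       / (3 * (real n - 1))"

definition gear_beta :: "nat \<Rightarrow> nat \<Rightarrow> real" where
  "gear_beta n j =
     (6 - real n - (-1) ^ j * sqrt 5 * sqrt (real n * (2 * real n - 9) + 12))
       / (3 * (real n - 1))"

definition gear_x :: "nat \<Rightarrow> nat \<Rightarrow> complex vec" where
  "gear_x n j = vCons (of_real (gear_alpha n j))
     ((of_real (gear_beta n j) \<cdot>\<^sub>v ones_vec (n - 1)) @\<^sub>v ones_vec (n - 1))"

definition gear_nabla :: "nat \<Rightarrow> nat set" where
  "gear_nabla n = {1..n - 2} - {(n - 1) div 2}"

text \<open>The \<open>else\<close> branches are the case \<open>k = (n - 1) / 2\<close>: here \<open>n\<close> is odd and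
  \<open>k\<close> ranges over \<open>{1..n - 2}\<close>.\<close>

definition gear_v :: "nat \<Rightarrow> nat \<Rightarrow> complex vec" where
  "gear_v n k = (if k \<in> gear_nabla n then vec (n - 1) (\<lambda>i. gear_omega n ^ (i * k))
     else 0\<^sub>v (n - 1))"

definition gear_u :: "nat \<Rightarrow> nat \<Rightarrow> complex vec" where
  "gear_u n k = (if k \<in> gear_nabla n
     then of_real (- 1 / (8 * (cos (pi * real k / real (n - 1)))\<^sup>2)) \<cdot>\<^sub>v (gear_S n *\<^sub>v gear_v n k)
     else vec (n - 1) (\<lambda>i. (-1) ^ i))"

definition gear_q :: "nat \<Rightarrow> nat \<Rightarrow> complex vec" where
  "gear_q n k = vCons 0 (gear_u n k @\<^sub>v gear_v n k)"

end

theory Submission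
  imports Defs
begin

text \<open>With \<open>\<zeta> = \<omega>\<^sup>k\<close> and \<open>w = (1, \<zeta>, \<zeta>\<^sup>2, \<dots>)\<close>, both blocks of \<open>q\<^sub>k\<close> are multiples of \<open>w\<close>, also for
  \<open>k = (n - 1) / 2\<close>, where \<open>\<zeta> = -1\<close>. Circulant matrices are diagonalised by \<open>w\<close>: since the
  powers of \<open>\<zeta>\<close> sum to 0, the eigenvalues of \<open>S\<close>, \<open>S'\<close>, \<open>T\<close>, \<open>J\<close> are \<open>-2 (1 + \<zeta>\<^sup>*)\<close>,
  \<open>-2 (1 + \<zeta>)\<close>, \<open>-2 |1 + \<zeta>|\<^sup>2\<close>, \<open>0\<close>, and \<open>|1 + \<zeta>|\<^sup>2 = 4 cos\<^sup>2 (\<pi> k / (n - 1))\<close>. Hence (i) reduces to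
  scalar identities, and (ii)-(iv) hold because the vectors \<open>w\<close> for distinct \<open>k\<close>, including \<open>1\<close>
  for \<open>k = 0\<close>, are orthogonal.\<close>

section \<open>Vectors of powers and roots of unity\<close>

definition powers_vec :: "nat \<Rightarrow> complex \<Rightarrow> complex vec" where
  "powers_vec p z = vec p (\<lambda>i. z ^ i)"

lemma powers_vec_carrier [simp]: "powers_vec p z \<in> carrier_vec p"
  and dim_powers_vec [simp]: "dim_vec (powers_vec p z) = p"
  and index_powers_vec [simp]: "i < p \<Longrightarrow> powers_vec p z $ i = z ^ i"
  by (simp_all add: powers_vec_def)

lemma ones_vec_eq_powers_vec: "ones_vec p = powers_vec p 1"
  by (simp add: ones_vec_def powers_vec_def)

lemma power_mod_of_root_of_unity:
  fixes z :: complex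
  assumes "z ^ p = 1"
  shows "z ^ (d mod p) = z ^ d"
proof -
  have "z ^ d = z ^ (p * (d div p) + d mod p)" by simp
  also have "\<dots> = z ^ (d mod p)" using assms by (simp only: power_add power_mult) simp
  finally show ?thesis by simp
qed

lemma sum_powers_root_of_unity:
  fixes z :: complex
  assumes "z ^ p = 1" "z \<noteq> 1"
  shows "(\<Sum>i<p. z ^ i) = 0"
  using assms by (simp add: sum_gp_strict)

text \<open>The norm is a nonnegative real whose \<open>p\<close>-th power is 1, so it is 1. This
  lets \<open>cnj z\<close> play the part of the inverse of \<open>z\<close>, so that negative
  exponents become powers of \<open>cnj z\<close>.\<close>

lemma cnj_mult_root_of_unity:
  fixes z :: complex
  assumes "z ^ p = 1" "p > 0"
  shows "z * cnj z = 1" "cnj z * z = 1"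
proof -
  have "norm z ^ p = 1" using assms by (metis norm_one norm_power)
  hence "norm z = 1" using power_eq_imp_eq_base[of "norm z" p 1] assms(2) by simp
  thus "z * cnj z = 1" by (simp add: complex_norm_square[symmetric])
  thus "cnj z * z = 1" by (simp add: mult.commute)
qed

section \<open>Circulant matrices acting on vectors of powers\<close>

text \<open>Reindexes the sum over row \<open>i\<close> of a circulant matrix by positions in its
  first row; adding \<open>i\<close> modulo \<open>p\<close> undoes the shift.\<close>

lemma bij_betw_shift_mod:
  fixes i p :: nat
  assumes "i < p"
  shows "bij_betw (\<lambda>j. (j + p - i) mod p) {..<p} {..<p}"
proof (rule bij_betw_byWitness[where f' = "\<lambda>d. (d + i) mod p"])
  show "\<forall>j\<in>{..<p}. ((j + p - i) mod p + i) mod p = j"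
    using assms by (auto simp: mod_simps)
  show "\<forall>d\<in>{..<p}. ((d + i) mod p + p - i) mod p = d"
  proof
    fix d assume "d \<in> {..<p}"
    have "((d + i) mod p + p - i) mod p = ((d + i) mod p + (p - i)) mod p"
      using assms by simp
    also have "\<dots> = (d + i + (p - i)) mod p" by (simp only: mod_simps)
    also have "\<dots> = d" using assms \<open>d \<in> {..<p}\<close> by simp
    finally show "((d + i) mod p + p - i) mod p = d" .
  qed
qed (use assms in auto)

text \<open>The counterpart for row \<open>i\<close> of the transpose. The map is an involution,
  hence its own witness for the inverse.\<close>

lemma bij_betw_reflect_mod:
  fixes i p :: nat
  assumes "i < p"
  shows "bij_betw (\<lambda>j. (i + p - j) mod p) {..<p} {..<p}"
proof (rule bij_betw_byWitness[where f' = "\<lambda>j. (i + p - j) mod p"])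
  show "\<forall>j\<in>{..<p}. (i + p - (i + p - j) mod p) mod p = j"
  proof
    fix j assume "j \<in> {..<p}"
    show "(i + p - (i + p - j) mod p) mod p = j"
    \<comment> \<open>The residue wraps around exactly when \<open>j \<le> i\<close>, since then
      \<open>i + p - j\<close> is at least \<open>p\<close>.\<close>
    proof (cases "j \<le> i")
      case True
      hence "(i + p - j) mod p = i - j"
        using assms by (metis Nat.add_diff_assoc2 less_imp_diff_less mod_add_self2 mod_less)
      thus ?thesis using True \<open>j \<in> {..<p}\<close> by simp
    next
      case False
      hence "(i + p - j) mod p = i + p - j" using \<open>j \<in> {..<p}\<close> by simp
      thus ?thesis using False \<open>j \<in> {..<p}\<close> by simp
    qed
  qed
  thus "\<forall>j\<in>{..<p}. (i + p - (i + p - j) mod p) mod p = j" .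
qed (use assms in auto)

lemma circ_mat_carrier [simp]: "circ_mat as \<in> carrier_mat (length as) (length as)"
  by (simp add: circ_mat_def)

text \<open>Put \<open>d = j - i\<close> modulo \<open>p\<close>. Exponents of \<open>z\<close>
  matter only modulo \<open>p\<close>, so \<open>z ^ j\<close> splits as
  \<open>z ^ d * z ^ i\<close>; the factor \<open>z ^ i\<close> leaves the sum, and what remains is
  the same for every row.\<close>

lemma circ_mat_mult_powers_vec:
  assumes "length as = p" "z ^ p = 1"
  shows "circ_mat as *\<^sub>v powers_vec p z = (\<Sum>d<p. as ! d * z ^ d) \<cdot>\<^sub>v powers_vec p z"
proof (rule eq_vecI)
  fix i assume "i < dim_vec ((\<Sum>d<p. as ! d * z ^ d) \<cdot>\<^sub>v powers_vec p z)"
  hence i: "i < p" by simp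
  have "(circ_mat as *\<^sub>v powers_vec p z) $ i = (\<Sum>j<p. as ! ((j + p - i) mod p) * z ^ j)"
    using i assms(1) by (simp add: circ_mat_def scalar_prod_def atLeast0LessThan)
  also have "\<dots> = (\<Sum>j<p. as ! ((j + p - i) mod p) * z ^ ((j + p - i) mod p) * z ^ i)"
  proof (rule sum.cong)
    fix j
    have "z ^ ((j + p - i) mod p) * z ^ i = z ^ (j + p)"
      using i by (simp add: power_mod_of_root_of_unity[OF assms(2)] flip: power_add)
    thus "as ! ((j + p - i) mod p) * z ^ j
        = as ! ((j + p - i) mod p) * z ^ ((j + p - i) mod p) * z ^ i"
      using assms(2) by (simp add: power_add mult.assoc)
  qed simp
  also have "\<dots> = (\<Sum>d<p. as ! d * z ^ d * z ^ i)"
    by (rule sum.reindex_bij_betw[OF bij_betw_shift_mod[OF i]])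
  finally show "(circ_mat as *\<^sub>v powers_vec p z) $ i
      = ((\<Sum>d<p. as ! d * z ^ d) \<cdot>\<^sub>v powers_vec p z) $ i"
    using i by (simp add: sum_distrib_right)
qed (use assms in \<open>simp add: circ_mat_def\<close>)

text \<open>Transposing replaces the offset \<open>j - i\<close> by \<open>i - j\<close>, so
  \<open>z ^ j\<close> is \<open>z ^ i\<close> times a negative power of \<open>z\<close>, which is
  a power of \<open>cnj z\<close>.\<close>

lemma transpose_circ_mat_mult_powers_vec:
  assumes "length as = p" "z ^ p = 1"
  shows "transpose_mat (circ_mat as) *\<^sub>v powers_vec p z
    = (\<Sum>d<p. as ! d * cnj z ^ d) \<cdot>\<^sub>v powers_vec p z"
proof (rule eq_vecI)
  fix i assume "i < dim_vec ((\<Sum>d<p. as ! d * cnj z ^ d) \<cdot>\<^sub>v powers_vec p z)"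
  hence i: "i < p" by simp
  have unit: "z * cnj z = 1" using cnj_mult_root_of_unity[OF assms(2)] i by simp
  have cnj: "cnj z ^ p = 1" using assms(2) by (metis complex_cnj_one complex_cnj_power)
  have "(transpose_mat (circ_mat as) *\<^sub>v powers_vec p z) $ i
      = (\<Sum>j<p. as ! ((i + p - j) mod p) * z ^ j)"
    using i assms(1) by (simp add: circ_mat_def scalar_prod_def atLeast0LessThan)
  also have "\<dots> = (\<Sum>j<p. as ! ((i + p - j) mod p) * cnj z ^ ((i + p - j) mod p) * z ^ i)"
  proof (rule sum.cong)
    fix j assume "j \<in> {..<p}"
    hence "z ^ (i + p - j) * z ^ j = z ^ (i + p)" by (simp flip: power_add)
    hence "z ^ i = z ^ (i + p - j) * z ^ j" using assms(2) by (simp add: power_add)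
    \<comment> \<open>Equal powers of \<open>z\<close> and \<open>cnj z\<close> are paired, so that
      their product collapses to 1.\<close>
    hence "cnj z ^ ((i + p - j) mod p) * z ^ i = (z * cnj z) ^ (i + p - j) * z ^ j"
      by (simp add: power_mod_of_root_of_unity[OF cnj] power_mult_distrib)
    thus "as ! ((i + p - j) mod p) * z ^ j
        = as ! ((i + p - j) mod p) * cnj z ^ ((i + p - j) mod p) * z ^ i"
      using unit by (simp add: mult.assoc)
  qed simp
  also have "\<dots> = (\<Sum>d<p. as ! d * cnj z ^ d * z ^ i)"
    by (rule sum.reindex_bij_betw[OF bij_betw_reflect_mod[OF i]])
  finally show "(transpose_mat (circ_mat as) *\<^sub>v powers_vec p z) $ i
      = ((\<Sum>d<p. as ! d * cnj z ^ d) \<cdot>\<^sub>v powers_vec p z) $ i"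
    using i by (simp add: sum_distrib_right)
qed (use assms in \<open>simp add: circ_mat_def\<close>)

section \<open>Eigenvalues of the blocks \<open>S\<close>, \<open>S'\<close> and
  \<open>T\<close>\<close>

lemma power_pred_root_of_unity:
  fixes z :: complex
  assumes "z ^ p = 1" "p > 0"
  shows "z ^ (p - 1) = cnj z"
proof -
  have "z ^ (p - 1) = z ^ (p - 1) * z * cnj z"
    using cnj_mult_root_of_unity[OF assms] by (simp add: mult.assoc)
  also have "z ^ (p - 1) * z = 1" using assms by (metis power_minus_mult)
  finally show ?thesis by simp
qed

text \<open>The first row is the constant 3 with 2 subtracted at the positions 0 and
  \<open>n - 2\<close>. The constant part sums to 0, and the last position contributes
  \<open>z ^ (n - 2) = cnj z\<close>.\<close>

lemma gear_S_symbol: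
  fixes z :: complex
  assumes "n \<ge> 5" "z ^ (n - 1) = 1" "z \<noteq> 1"
  shows "(\<Sum>d<n - 1. (1 # replicate (n - 3) 3 @ [1]) ! d * z ^ d) = - 2 * (1 + cnj z)"
proof -
  have "(\<Sum>d<n - 1. (1 # replicate (n - 3) 3 @ [1]) ! d * z ^ d)
      = (\<Sum>d<n - 1. 3 * z ^ d - (if d = 0 then 2 * z ^ d else 0)
          - (if d = n - 2 then 2 * z ^ d else 0))"
    by (rule sum.cong) (use assms in \<open>auto simp: nth_Cons nth_append split: nat.split\<close>)
  also have "\<dots> = 3 * (\<Sum>d<n - 1. z ^ d) - 2 - 2 * z ^ (n - 2)"
    using assms(1) by (simp add: sum_subtractf sum_distrib_left)
  also have "z ^ (n - 2) = cnj z"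
    using power_pred_root_of_unity[OF assms(2)] assms(1) by (simp add: numeral_2_eq_2)
  finally show ?thesis using sum_powers_root_of_unity[OF assms(2,3)] by simp
qed

text \<open>The first row is the constant 4 minus 4, 2, 2 at the positions 0, 1,
  \<open>n - 2\<close>, which are distinct for \<open>n \<ge> 5\<close>. The rest,
  \<open>- 4 - 2 * z - 2 * cnj z\<close>, factors because \<open>z * cnj z = 1\<close>.\<close>

lemma gear_T_symbol:
  fixes z :: complex
  assumes "n \<ge> 5" "z ^ (n - 1) = 1" "z \<noteq> 1"
  shows "(\<Sum>d<n - 1. (0 # 2 # replicate (n - 4) 4 @ [2]) ! d * z ^ d)
    = - 2 * ((1 + z) * (1 + cnj z))"
proof -
  have "(\<Sum>d<n - 1. (0 # 2 # replicate (n - 4) 4 @ [2]) ! d * z ^ d)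
      = (\<Sum>d<n - 1. 4 * z ^ d - (if d = 0 then 4 * z ^ d else 0)
          - (if d = 1 then 2 * z ^ d else 0) - (if d = n - 2 then 2 * z ^ d else 0))"
    by (rule sum.cong) (use assms in \<open>auto simp: nth_Cons nth_append split: nat.split\<close>)
  also have "\<dots> = 4 * (\<Sum>d<n - 1. z ^ d) - 4 - 2 * z - 2 * z ^ (n - 2)"
  proof -
    have "1 < n - 1" "n - 2 < n - 1" using assms(1) by auto
    thus ?thesis by (simp add: sum_subtractf sum_distrib_left)
  qed
  also have "z ^ (n - 2) = cnj z"
    using power_pred_root_of_unity[OF assms(2)] assms(1) by (simp add: numeral_2_eq_2)
  also have "4 * (\<Sum>d<n - 1. z ^ d) - 4 - 2 * z - 2 * cnj z = - 2 * ((1 + z) * (1 + cnj z))"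
    using sum_powers_root_of_unity[OF assms(2,3)] cnj_mult_root_of_unity[OF assms(2)] assms(1)
    by (simp add: algebra_simps)
  finally show ?thesis .
qed

lemma gear_S_carrier: "gear_S n \<in> carrier_mat (n - 1) (n - 1)" if "n \<ge> 5"
proof -
  have "length (1 # replicate (n - 3) 3 @ [1] :: complex list) = n - 1" using that by simp
  thus ?thesis using circ_mat_carrier unfolding gear_S_def by metis
qed

lemma gear_T_carrier: "gear_T n \<in> carrier_mat (n - 1) (n - 1)" if "n \<ge> 5"
proof -
  have "length (0 # 2 # replicate (n - 4) 4 @ [2] :: complex list) = n - 1" using that by simp
  thus ?thesis using circ_mat_carrier unfolding gear_T_def by metis
qed

lemma gear_S_mult_powers_vec:
  assumes "n \<ge> 5" "z ^ (n - 1) = 1" "z \<noteq> 1"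
  shows "gear_S n *\<^sub>v powers_vec (n - 1) z = (- 2 * (1 + cnj z)) \<cdot>\<^sub>v powers_vec (n - 1) z"
proof -
  have "length (1 # replicate (n - 3) 3 @ [1] :: complex list) = n - 1" using assms(1) by simp
  from circ_mat_mult_powers_vec[OF this assms(2)] show ?thesis
    by (simp only: gear_S_def gear_S_symbol[OF assms])
qed

lemma transpose_gear_S_mult_powers_vec:
  assumes "n \<ge> 5" "z ^ (n - 1) = 1" "z \<noteq> 1"
  shows "transpose_mat (gear_S n) *\<^sub>v powers_vec (n - 1) z
    = (- 2 * (1 + z)) \<cdot>\<^sub>v powers_vec (n - 1) z"
proof -
  \<comment> \<open>The eigenvalue of the transpose is the sum for \<open>S\<close> taken at
    \<open>cnj z\<close>, which is again a root of unity other than 1.\<close>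
  have "cnj z ^ (n - 1) = 1" "cnj z \<noteq> 1"
    using assms by (metis complex_cnj_one complex_cnj_power, metis complex_cnj_cnj complex_cnj_one)
  note sym = gear_S_symbol[OF assms(1) this]
  have "length (1 # replicate (n - 3) 3 @ [1] :: complex list) = n - 1" using assms(1) by simp
  from transpose_circ_mat_mult_powers_vec[OF this assms(2)] show ?thesis
    by (simp only: gear_S_def sym complex_cnj_cnj)
qed

lemma gear_T_mult_powers_vec:
  assumes "n \<ge> 5" "z ^ (n - 1) = 1" "z \<noteq> 1"
  shows "gear_T n *\<^sub>v powers_vec (n - 1) z
    = (- 2 * ((1 + z) * (1 + cnj z))) \<cdot>\<^sub>v powers_vec (n - 1) z"
proof -
  have "length (0 # 2 # replicate (n - 4) 4 @ [2] :: complex list) = n - 1" using assms(1) by simp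
  from circ_mat_mult_powers_vec[OF this assms(2)] show ?thesis
    by (simp only: gear_T_def gear_T_symbol[OF assms])
qed

section \<open>The block matrix \<open>E\<close> on vectors with first entry 0\<close>

lemma ones_row_carrier [simp]: "ones_row p \<in> carrier_mat (Suc 0) p"
  and ones_col_carrier [simp]: "ones_col p \<in> carrier_mat p (Suc 0)"
  by (simp_all add: ones_row_def ones_col_def ones_vec_def mat_of_cols_def)

lemma ones_row_mult_vec:
  assumes "ones_vec p \<bullet> u = 0"
  shows "ones_row p *\<^sub>v u = 0\<^sub>v 1"
  by (rule eq_vecI) (use assms in \<open>auto simp: ones_row_def\<close>)

text \<open>The zero entry cancels the first column of \<open>E\<close>. Orthogonality to the
  all-ones vector makes the first row give 0 and reduces \<open>2 (J - I)\<close> to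
  \<open>-2 I\<close>.\<close>

lemma gear_E_mult_vec:
  assumes n: "n \<ge> 5"
    and u: "u \<in> carrier_vec (n - 1)" "ones_vec (n - 1) \<bullet> u = 0"
    and v: "v \<in> carrier_vec (n - 1)" "ones_vec (n - 1) \<bullet> v = 0"
  shows "gear_E n *\<^sub>v vCons 0 (u @\<^sub>v v)
    = vCons 0 ((gear_S n *\<^sub>v v - 2 \<cdot>\<^sub>v u) @\<^sub>v (transpose_mat (gear_S n) *\<^sub>v u + gear_T n *\<^sub>v v))"
proof -
  define m where "m = n - 1"
  let ?S = "gear_S n"
  let ?A = "four_block_mat (0\<^sub>m 1 1) (ones_row m) (ones_col m) (2 \<cdot>\<^sub>m (J_mat m - 1\<^sub>m m))"
  let ?B = "(2 \<cdot>\<^sub>m ones_row m) @\<^sub>r ?S"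
  note um = u[folded m_def] and vm = v[folded m_def]
  have S: "?S \<in> carrier_mat m m" and T: "gear_T n \<in> carrier_mat m m"
    using gear_S_carrier gear_T_carrier n by (simp_all add: m_def)
  have K: "2 \<cdot>\<^sub>m (J_mat m - 1\<^sub>m m) \<in> carrier_mat m m"
    unfolding J_mat_def by (intro smult_carrier_mat minus_carrier_mat) simp
  have A: "?A \<in> carrier_mat (1 + m) (1 + m)" using K by (intro four_block_carrier_mat) auto
  have R: "2 \<cdot>\<^sub>m ones_row m \<in> carrier_mat 1 m" by simp
  have B: "?B \<in> carrier_mat (1 + m) m" using R S by (rule carrier_append_rows)
  \<comment> \<open>\<open>gear_E\<close> is partitioned as \<open>n + (n - 1)\<close>, with the
    first block split again as \<open>1 + (n - 1)\<close>; the vector has to follow the same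
    nesting.\<close>
  have split: "vCons 0 u = 0\<^sub>v 1 @\<^sub>v u" for u :: "complex vec"
    by (rule eq_vecI) (auto simp: vec_index_vCons)
  have col0: "ones_col m *\<^sub>v 0\<^sub>v (Suc 0) = 0\<^sub>v m"
    by (rule eq_vecI) (auto simp: ones_col_def scalar_prod_def)
  have Ju: "J_mat m *\<^sub>v u = 0\<^sub>v m"
  proof -
    have "J_mat m *\<^sub>v u = ones_col m *\<^sub>v (ones_row m *\<^sub>v u)"
      unfolding J_mat_def by (rule assoc_mult_mat_vec[of _ m 1 _ m]) (use um in auto)
    also have "\<dots> = ones_col m *\<^sub>v 0\<^sub>v 1" using um by (simp add: ones_row_mult_vec)
    finally show ?thesis by (simp add: col0)
  qed
  have Ku: "(2 \<cdot>\<^sub>m (J_mat m - 1\<^sub>m m)) *\<^sub>v u = - (2 \<cdot>\<^sub>v u)"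
  proof -
    have J: "J_mat m \<in> carrier_mat m m"
      unfolding J_mat_def by (rule mult_carrier_mat[of _ m 1]) simp_all
    have "(2 \<cdot>\<^sub>m (J_mat m - 1\<^sub>m m)) *\<^sub>v u = 2 \<cdot>\<^sub>v (J_mat m *\<^sub>v u - 1\<^sub>m m *\<^sub>v u)"
      using J um by (subst minus_mult_distrib_mat_vec[symmetric]) auto
    thus ?thesis using um by (auto simp: Ju intro!: eq_vecI)
  qed
  have Au: "?A *\<^sub>v vCons 0 u = 0\<^sub>v 1 @\<^sub>v - (2 \<cdot>\<^sub>v u)"
    unfolding split using K um
    by (subst four_block_mat_mult_vec) (auto simp: ones_row_mult_vec Ku col0 intro!: eq_vecI)
  have Bv: "?B *\<^sub>v v = 0\<^sub>v 1 @\<^sub>v (?S *\<^sub>v v)"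
  proof -
    have "(2 \<cdot>\<^sub>m ones_row m) *\<^sub>v v = 0\<^sub>v 1"
      by (rule eq_vecI) (use vm in \<open>auto simp: ones_row_def ones_vec_def\<close>)
    thus ?thesis by (simp only: mat_mult_append[OF R S vm(1)])
  qed
  have Bu: "transpose_mat ?B *\<^sub>v vCons 0 u = transpose_mat ?S *\<^sub>v u"
  proof -
    let ?R = "2 \<cdot>\<^sub>m ones_row m"
    \<comment> \<open>Appending rows is a block matrix whose right column of blocks has width 0. Its
      transpose therefore has a lower row of blocks of height 0, which contributes an empty vector
      to the product.\<close>
    have "transpose_mat ?B
        = four_block_mat (transpose_mat ?R) (transpose_mat ?S) (0\<^sub>m 0 1) (0\<^sub>m 0 m)"
      unfolding append_rows_def carrier_matD(1)[OF R] carrier_matD(1)[OF S]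
      using transpose_four_block_mat[OF R zero_carrier_mat S zero_carrier_mat] by simp
    hence "transpose_mat ?B *\<^sub>v vCons 0 u
        = (transpose_mat ?R *\<^sub>v 0\<^sub>v 1 + transpose_mat ?S *\<^sub>v u)
          @\<^sub>v (0\<^sub>m 0 1 *\<^sub>v 0\<^sub>v 1 + 0\<^sub>m 0 m *\<^sub>v u)"
      unfolding split
      by (simp only:, intro four_block_mat_mult_vec[where ?nr1.0 = m])
         (use R S um in \<open>auto simp del: One_nat_def\<close>)
    moreover have "transpose_mat ?R *\<^sub>v 0\<^sub>v 1 = 0\<^sub>v m"
      by (rule eq_vecI) (auto simp: scalar_prod_def ones_row_def ones_vec_def)
    ultimately show ?thesis using S by (auto intro!: eq_vecI)
  qed
  have "gear_E n *\<^sub>v vCons 0 (u @\<^sub>v v)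
      = four_block_mat ?A ?B (transpose_mat ?B) (gear_T n) *\<^sub>v (vCons 0 u @\<^sub>v v)"
    by (simp add: gear_E_def m_def)
  also have "\<dots> = (?A *\<^sub>v vCons 0 u + ?B *\<^sub>v v) @\<^sub>v (transpose_mat ?B *\<^sub>v vCons 0 u + gear_T n *\<^sub>v v)"
    by (rule four_block_mat_mult_vec[OF A B _ T]) (use B um vm in auto)
  also have "?A *\<^sub>v vCons 0 u + ?B *\<^sub>v v = vCons 0 (?S *\<^sub>v v - 2 \<cdot>\<^sub>v u)"
    unfolding Au Bv unfolding split using um S by (auto intro!: eq_vecI)
  finally show ?thesis by (simp add: Bu)
qed

section \<open>Orthogonality of vectors of powers\<close>

text \<open>The inner product is the geometric sum of \<open>z * cnj y\<close>, a root of unity that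
  differs from 1 because \<open>cnj y\<close> is the inverse of \<open>y\<close>.\<close>

lemma scalar_prod_powers_vec_eq_0:
  assumes "z ^ p = 1" "y ^ p = 1" "z \<noteq> y"
  shows "powers_vec p z \<bullet>c powers_vec p y = 0"
proof (cases "p = 0")
  case False
  have "powers_vec p z \<bullet>c powers_vec p y = (\<Sum>i<p. (z * cnj y) ^ i)"
    by (simp add: scalar_prod_def atLeast0LessThan power_mult_distrib)
  moreover have "(z * cnj y) ^ p = 1"
    using assms by (simp add: power_mult_distrib flip: complex_cnj_power)
  moreover have "z * cnj y \<noteq> 1"
  proof
    assume "z * cnj y = 1"
    hence "z * (cnj y * y) = y" by (simp flip: mult.assoc)
    thus False using cnj_mult_root_of_unity[OF assms(2)] False assms(3) by simp
  qed
  ultimately show ?thesis using sum_powers_root_of_unity by metis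
qed (simp add: scalar_prod_def)

text \<open>Each of the two blocks contributes 0 separately, and \<open>c\<close> meets the entry 0.
  The shape covers \<open>x_j\<close>, the all-ones vector and every \<open>q_k\<close> on the
  left.\<close>

lemma scalar_prod_block_powers_vec_eq_0:
  assumes "z ^ p = 1" "y ^ p = 1" "z \<noteq> y"
  shows "vCons c ((a \<cdot>\<^sub>v powers_vec p z) @\<^sub>v (b \<cdot>\<^sub>v powers_vec p z))
    \<bullet>c vCons 0 ((a' \<cdot>\<^sub>v powers_vec p y) @\<^sub>v (b' \<cdot>\<^sub>v powers_vec p y)) = 0"
proof -
  have "conjugate (v @\<^sub>v w) = conjugate v @\<^sub>v conjugate w" for v w :: "complex vec"
    by (rule eq_vecI) auto
  thus ?thesis using scalar_prod_powers_vec_eq_0[OF assms]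
    by (subst conjugate_vCons)
       (simp add: scalar_prod_append[where ?n1.0 = p and ?n2.0 = p] conjugate_smult_vec)
qed

section \<open>Powers of \<open>\<omega>\<close> and the cosines\<close>

lemma gear_omega_power:
  assumes "n \<ge> 2"
  shows "gear_omega n ^ k = cis (2 * pi * real k / real (n - 1))"
proof -
  have "gear_omega n = cis (2 * pi / real (n - 1))"
    by (simp add: gear_omega_def cis_conv_exp mult_ac)
  thus ?thesis by (simp add: DeMoivre mult_ac)
qed

lemma gear_omega_power_root_of_unity:
  assumes "n \<ge> 2"
  shows "(gear_omega n ^ k) ^ (n - 1) = 1"
proof -
  have "gear_omega n ^ (n - 1) = 1" using assms by (simp add: gear_omega_power)
  thus ?thesis by (metis power_mult mult.commute power_one)
qed

lemma gear_omega_power_inj: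
  assumes "n \<ge> 2" "k < n - 1" "l < n - 1" "gear_omega n ^ k = gear_omega n ^ l"
  shows "k = l"
proof -
  have "inj_on (\<lambda>k. cis (2 * pi * real k / real (n - 1))) {..<n - 1}"
    using bij_betw_roots_unity[of "n - 1"] assms by (simp add: bij_betw_def)
  thus ?thesis using assms by (auto simp: gear_omega_power dest: inj_onD)
qed

lemma gear_omega_power_ne_1:
  assumes "n \<ge> 2" "k \<in> {1..n - 2}"
  shows "gear_omega n ^ k \<noteq> 1"
proof
  assume "gear_omega n ^ k = 1"
  moreover have "k < n - 1" "0 < n - 1" using assms by auto
  ultimately have "k = 0" using gear_omega_power_inj[OF assms(1), of k 0] by simp
  thus False using assms by simp
qed

text \<open>With \<open>t = pi * k / (n - 1)\<close> the power of \<open>\<omega>\<close> is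
  \<open>cis (2 * t)\<close>, and expanding leaves \<open>2 + 2 * cos (2 * t)\<close>, which the
  double angle formula turns into \<open>4 * (cos t)\<^sup>2\<close>.\<close>

lemma gear_omega_norm_square:
  assumes "n \<ge> 2"
  shows "(1 + gear_omega n ^ k) * (1 + cnj (gear_omega n ^ k))
    = of_real (4 * (cos (pi * real k / real (n - 1)))\<^sup>2)"
proof -
  define t where "t = pi * real k / real (n - 1)"
  have "gear_omega n ^ k = cis (2 * t)"
    using gear_omega_power[OF assms] by (simp add: t_def mult.assoc)
  moreover have "(1 + cis (2 * t)) * (1 + cnj (cis (2 * t))) = of_real (2 + 2 * cos (2 * t))"
    using sin_cos_squared_add[of "2 * t"]
    by (simp add: complex_eq_iff algebra_simps power2_eq_square)
  moreover have "2 + 2 * cos (2 * t) = 4 * (cos t)\<^sup>2" by (simp add: cos_double_cos)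
  ultimately show ?thesis by (simp only: t_def)
qed

text \<open>The angle lies in \<open>[0, pi]\<close>, where the cosine vanishes only at
  \<open>pi / 2\<close>; this would force \<open>2 * k = n - 1\<close>, the index left out of
  \<open>gear_nabla\<close>. It justifies the division in \<open>gear_u\<close>.\<close>

lemma cos_gear_angle_nonzero:
  assumes "odd n" "k \<in> gear_nabla n"
  shows "cos (pi * real k / real (n - 1)) \<noteq> 0"
proof
  assume "cos (pi * real k / real (n - 1)) = 0"
  hence eq: "cos (pi * real k / real (n - 1)) = cos (pi / 2)" by simp
  have k: "1 \<le> k" "k \<le> n - 2" "k \<noteq> (n - 1) div 2" using assms by (auto simp: gear_nabla_def)
  hence "real k \<le> real (n - 1)" "real (n - 1) > 0" by auto
  hence "pi * real k / real (n - 1) \<le> pi"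
    by (simp add: pos_divide_le_eq del: of_nat_diff)
  hence "pi * real k / real (n - 1) = pi / 2"
    by (intro cos_inj_pi[OF _ _ _ _ eq]) simp_all
  hence "pi * (real k / real (n - 1)) = pi * (1 / 2)" by simp
  hence "real k / real (n - 1) = 1 / 2" using pi_neq_zero mult_left_cancel by blast
  hence "2 * real k = real (n - 1)"
    using \<open>real (n - 1) > 0\<close> by (simp add: field_simps del: of_nat_diff)
  hence "2 * k = n - 1" by linarith
  thus False using k by linarith
qed

section \<open>The vectors \<open>q_k\<close> and their eigenvalue equation\<close>

text \<open>A common form for both cases in the definition of \<open>q_k\<close>. The last equation
  is the eigenvalue equation of the upper block; \<open>(1 + z) * a = b\<close> is what the lower
  block needs.\<close>

lemma gear_q_eq_powers_vec:
  assumes "n \<ge> 5" "odd n" "k \<in> {1..n - 2}"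
  defines "z \<equiv> gear_omega n ^ k"
  obtains a b where
    "gear_q n k = vCons 0 ((a \<cdot>\<^sub>v powers_vec (n - 1) z) @\<^sub>v (b \<cdot>\<^sub>v powers_vec (n - 1) z))"
    "(1 + z) * a = b"
    "- 2 * (1 + cnj z) * b - 2 * a = of_real (gear_theta n k) * a"
proof -
  define C where "C = (cos (pi * real k / real (n - 1)))\<^sup>2"
  have root: "z ^ (n - 1) = 1"
    unfolding z_def using assms(1) by (intro gear_omega_power_root_of_unity) simp
  have "z \<noteq> 1" unfolding z_def by (rule gear_omega_power_ne_1) (use assms in auto)
  have norm: "(1 + z) * (1 + cnj z) = of_real (4 * C)"
    unfolding z_def C_def using assms(1) by (intro gear_omega_norm_square) simp
  have theta: "gear_theta n k = - 8 * C - 2" by (simp add: gear_theta_def C_def)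
  show thesis
  proof (cases "k \<in> gear_nabla n")
    case True
    have "C \<noteq> 0" using cos_gear_angle_nonzero[OF assms(2) True] by (simp add: C_def)
    define a where "a = complex_of_real (- 1 / (8 * C)) * (- 2 * (1 + cnj z))"
    have v: "gear_v n k = powers_vec (n - 1) z"
      using True by (auto simp: gear_v_def z_def power_mult[symmetric] mult.commute intro!: eq_vecI)
    have u: "gear_u n k = a \<cdot>\<^sub>v powers_vec (n - 1) z"
      using True by (simp only: gear_u_def v gear_S_mult_powers_vec[OF assms(1) root \<open>z \<noteq> 1\<close>]
          smult_smult_assoc a_def C_def if_True)
    have "(1 + z) * a = of_real (- 1 / (8 * C)) * - 2 * ((1 + z) * (1 + cnj z))"
      by (simp only: a_def mult_ac)
    also have "\<dots> = 1" using \<open>C \<noteq> 0\<close> by (simp add: norm)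
    finally have b: "(1 + z) * a = 1" .
    \<comment> \<open>Solves the definition of \<open>a\<close> for the eigenvalue of
      \<open>S\<close>; subtracting \<open>2 * a\<close> then gives
      \<open>theta * a\<close>.\<close>
    have a: "- 2 * (1 + cnj z) = - 8 * of_real C * a"
      using \<open>C \<noteq> 0\<close> by (simp add: a_def field_simps)
    show ?thesis
    proof (rule that[of a 1])
      show "gear_q n k = vCons 0 ((a \<cdot>\<^sub>v powers_vec (n - 1) z) @\<^sub>v (1 \<cdot>\<^sub>v powers_vec (n - 1) z))"
        by (simp add: gear_q_def u v)
    qed (use a b in \<open>simp_all add: theta algebra_simps\<close>)
  next
    case False
    \<comment> \<open>Oddness of \<open>n\<close> makes \<open>(n - 1) div 2\<close> an exact
      half.\<close>
    hence k: "2 * k = n - 1" using assms by (auto simp: gear_nabla_def)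
    have "z = cis pi"
    proof -
      have "2 * real k = real (n - 1)" using k by (metis of_nat_mult of_nat_numeral)
      thus ?thesis unfolding z_def using assms k by (subst gear_omega_power) (auto simp: mult_ac)
    qed
    hence z: "z = - 1" by simp
    hence "C = 0" using norm by simp
    show ?thesis
    \<comment> \<open>The alternating vector is the vector of powers of \<open>z = - 1\<close>, and
      the zero block is its multiple by 0.\<close>
    proof (rule that[of 1 0])
      show "gear_q n k = vCons 0 ((1 \<cdot>\<^sub>v powers_vec (n - 1) z) @\<^sub>v (0 \<cdot>\<^sub>v powers_vec (n - 1) z))"
        using False by (auto simp: gear_q_def gear_u_def gear_v_def z powers_vec_def intro!: eq_vecI)
    qed (simp_all add: z theta \<open>C = 0\<close>)
  qed
qed

lemma gear_E_mult_gear_q: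
  assumes "n \<ge> 5" "odd n" "k \<in> {1..n - 2}"
  shows "gear_E n *\<^sub>v gear_q n k = complex_of_real (gear_theta n k) \<cdot>\<^sub>v gear_q n k"
proof -
  define z where "z = gear_omega n ^ k"
  let ?w = "powers_vec (n - 1) z"
  obtain a b where q: "gear_q n k = vCons 0 ((a \<cdot>\<^sub>v ?w) @\<^sub>v (b \<cdot>\<^sub>v ?w))"
    and ab: "(1 + z) * a = b"
    and eig: "- 2 * (1 + cnj z) * b - 2 * a = of_real (gear_theta n k) * a"
    using gear_q_eq_powers_vec[OF assms] unfolding z_def by metis
  have root: "z ^ (n - 1) = 1"
    unfolding z_def using assms(1) by (intro gear_omega_power_root_of_unity) simp
  have z: "z \<noteq> 1" unfolding z_def by (rule gear_omega_power_ne_1) (use assms in auto)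
  have orth: "ones_vec (n - 1) \<bullet> ?w = 0"
    using sum_powers_root_of_unity[OF root z]
    by (simp add: scalar_prod_def ones_vec_def atLeast0LessThan)
  have theta: "of_real (gear_theta n k) = - 2 * ((1 + z) * (1 + cnj z)) - 2"
    using gear_omega_norm_square[of n k] assms(1) by (simp add: gear_theta_def z_def)
  \<comment> \<open>By \<open>ab\<close> the first term is \<open>- 2 * b\<close>, which supplies
    the summand \<open>- 2\<close> of \<open>theta\<close>.\<close>
  have eig': "- 2 * (1 + z) * a - 2 * ((1 + z) * (1 + cnj z)) * b = of_real (gear_theta n k) * b"
    unfolding theta by (simp add: ab[symmetric] algebra_simps)
  have "gear_E n *\<^sub>v gear_q n k = vCons 0 ((gear_S n *\<^sub>v (b \<cdot>\<^sub>v ?w) - 2 \<cdot>\<^sub>v (a \<cdot>\<^sub>v ?w))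
      @\<^sub>v (transpose_mat (gear_S n) *\<^sub>v (a \<cdot>\<^sub>v ?w) + gear_T n *\<^sub>v (b \<cdot>\<^sub>v ?w)))"
    unfolding q using orth by (intro gear_E_mult_vec[OF assms(1)]) (simp_all add: ones_vec_def)
  also have "gear_S n *\<^sub>v (b \<cdot>\<^sub>v ?w) - 2 \<cdot>\<^sub>v (a \<cdot>\<^sub>v ?w) = (of_real (gear_theta n k) * a) \<cdot>\<^sub>v ?w"
    unfolding eig[symmetric]
    using gear_S_carrier[OF assms(1)] gear_S_mult_powers_vec[OF assms(1) root z]
    by (subst mult_mat_vec) (auto simp: algebra_simps intro!: eq_vecI)
  also have "transpose_mat (gear_S n) *\<^sub>v (a \<cdot>\<^sub>v ?w) + gear_T n *\<^sub>v (b \<cdot>\<^sub>v ?w)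
      = (of_real (gear_theta n k) * b) \<cdot>\<^sub>v ?w"
    unfolding eig'[symmetric]
    using gear_S_carrier[OF assms(1)] gear_T_carrier[OF assms(1)]
      transpose_gear_S_mult_powers_vec[OF assms(1) root z] gear_T_mult_powers_vec[OF assms(1) root z]
    by (subst (1 2) mult_mat_vec) (auto simp: algebra_simps intro!: eq_vecI)
  finally show ?thesis
    unfolding q by (auto simp: vec_index_vCons intro!: eq_vecI)
qed

theorem theorem6:
  fixes n :: nat
  assumes "n \<ge> 5" and "odd n"
  shows "(\<forall>k\<in>{1..n - 2}.
            gear_E n *\<^sub>v gear_q n k = complex_of_real (gear_theta n k) \<cdot>\<^sub>v gear_q n k)
       \<and> (\<forall>k\<in>{1..n - 2}. \<forall>l\<in>{1..n - 2}. k \<noteq> l \<longrightarrow> gear_q n k \<bullet>c gear_q n l = 0)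
       \<and> (\<forall>j\<in>{1, 2}. \<forall>k\<in>{1..n - 2}. gear_x n j \<bullet>c gear_q n k = 0)
       \<and> (\<forall>k\<in>{1..n - 2}. ones_vec (2 * n - 1) \<bullet>c gear_q n k = 0)"
proof -
  let ?w = "\<lambda>k. powers_vec (n - 1) (gear_omega n ^ k)"
  have n: "n \<ge> 2" using assms by simp
  \<comment> \<open>The index \<open>k\<close> may be 0 here: then \<open>?w 0\<close> is the
    all-ones vector, so that (iii) and (iv) become instances alongside (ii).\<close>
  have orth: "vCons c ((a \<cdot>\<^sub>v ?w k) @\<^sub>v (b \<cdot>\<^sub>v ?w k)) \<bullet>c gear_q n l = 0"
    if kl: "k \<in> {0..n - 2}" "l \<in> {1..n - 2}" "k \<noteq> l" for a b c k l
  proof -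
    obtain a' b' where q: "gear_q n l = vCons 0 ((a' \<cdot>\<^sub>v ?w l) @\<^sub>v (b' \<cdot>\<^sub>v ?w l))"
      using gear_q_eq_powers_vec[OF assms kl(2)] by metis
    have "k < n - 1" "l < n - 1" using kl n by auto
    hence "gear_omega n ^ k \<noteq> gear_omega n ^ l"
      using gear_omega_power_inj[OF n, of k l] kl(3) by auto
    thus ?thesis
      unfolding q by (intro scalar_prod_block_powers_vec_eq_0 gear_omega_power_root_of_unity n)
  qed
  have "gear_q n k \<bullet>c gear_q n l = 0" if kl: "k \<in> {1..n - 2}" "l \<in> {1..n - 2}" "k \<noteq> l" for k l
  proof -
    obtain a b where "gear_q n k = vCons 0 ((a \<cdot>\<^sub>v ?w k) @\<^sub>v (b \<cdot>\<^sub>v ?w k))"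
      using gear_q_eq_powers_vec[OF assms kl(1)] by metis
    thus ?thesis using orth[of k l] kl by simp
  qed
  moreover have "gear_x n j \<bullet>c gear_q n k = 0" if "k \<in> {1..n - 2}" for j k
    using orth[of 0 k _ _ 1] that by (simp add: gear_x_def ones_vec_eq_powers_vec)
  moreover have "ones_vec (2 * n - 1) \<bullet>c gear_q n k = 0" if "k \<in> {1..n - 2}" for k
  proof -
    have "ones_vec (2 * n - 1) = vCons 1 ((1 \<cdot>\<^sub>v ?w 0) @\<^sub>v (1 \<cdot>\<^sub>v ?w 0))"
      using n by (auto simp: ones_vec_def vec_index_vCons intro!: eq_vecI)
    thus ?thesis using orth[of 0 k 1 1 1] that by simp
  qed
  ultimately show ?thesis using gear_E_mult_gear_q[OF assms] by simp
qed

end
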